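(* Let $f\in\mathbb{Z}[x]$ be a monic irreducible polynomial of degree $n\ge2$. Then \[ \operatorname{SD}(f)\le\left(\frac{\|M_f\|_F^2}{n-1}\right)^{\frac{n-1}{2}}|\det M_f|^{\frac{1-n}{n}}, \] where $\|M_f\|_F^2=\sum_{i,j}|(M_f)_{ij}|^2$ is the squared Frobenius norm.
   Context: For a monic irreducible polynomial $f\in\mathbb{Z}[x]$ of degree $n$ with complex roots $\alpha_1,\dots,\alpha_n$, $M_f$ denotes the $n\times n$ Vandermonde matrix with $(i,j)$ entry $\alpha_i^{\,j-1}$. The spectral distortion of $f$ is $\operatorname{SD}(f)=\dfrac{|\det M_f|^{1/n}}{\sigma_{\min}(M_f)}$, where $\sigma_{\min}(M_f)$ is the smallest singular value of $M_f$. *)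

theory Defs
  imports
    "Jordan_Normal_Form.Schur_Decomposition"
    "Jordan_Normal_Form.Char_Poly"
begin

(* as lists the complex roots of f with multiplicity, in an arbitrary order *)
definition root_enumeration :: "int poly \<Rightarrow> complex list \<Rightarrow> bool" where
  "root_enumeration f as \<longleftrightarrow>
     map_poly of_int f = smult (of_int (lead_coeff f)) (\<Prod>a\<leftarrow>as. [:- a, 1:])"

lemma root_enumeration_exists: "\<exists>as. root_enumeration f as"
proof -
  define p :: "complex poly" where "p = map_poly of_int f"
  obtain as where "smult (coeff p (degree p)) (\<Prod>a\<leftarrow>as. [:- a, 1:]) = p"
    using fundamental_theorem_algebra_factorized[of p] by blast
  moreover have "coeff p (degree p) = of_int (lead_coeff f)"
    by (simp add: p_def)
  ultimately have "root_enumeration f as"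
    by (simp add: root_enumeration_def p_def)
  then show ?thesis ..
qed

lemma root_enumeration_length:
  assumes "root_enumeration f as" "f \<noteq> 0"
  shows "length as = degree f"
proof -
  have "degree f = degree (map_poly of_int f :: complex poly)"
    by (simp add: degree_map_poly)
  also have "\<dots> = degree (\<Prod>a\<leftarrow>as. [:- a, 1:])"
    using assms by (simp add: root_enumeration_def)
  also have "\<dots> = length as"
    by (rule degree_linear_factors)
  finally show ?thesis by simp
qed

(* indices are 0-based, so the entry a_i^(j-1) becomes (as ! i) ^ j *)
definition vandermonde_mat :: "complex list \<Rightarrow> complex mat" where
  "vandermonde_mat as = mat (length as) (length as) (\<lambda>(i, j). (as ! i) ^ j)"

definition singular_values :: "complex mat \<Rightarrow> real set" where
  "singular_values A =
     {s. s \<ge> 0 \<and> eigenvalue (mat_adjoint A * A) (complex_of_real (s\<^sup>2))}"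

definition sigma_min :: "complex mat \<Rightarrow> real" where
  "sigma_min A = Min (singular_values A)"

definition frobenius_norm :: "complex mat \<Rightarrow> real" where
  "frobenius_norm A = sqrt (\<Sum>i<dim_row A. \<Sum>j<dim_col A. (cmod (A $$ (i, j)))\<^sup>2)"

(* The value does not change when as is permuted: this permutes the rows of the
   Vandermonde matrix, which preserves the modulus of the determinant and the
   singular values. It therefore depends only on the polynomial with roots as. *)
definition spectral_distortion :: "complex list \<Rightarrow> real" where
  "spectral_distortion as =
     cmod (det (vandermonde_mat as)) powr (1 / real (length as)) / sigma_min (vandermonde_mat as)"

end

theory Submission
  imports Defs
begin

text \<open>
  The eigenvalues of \<open>M\<^sup>* M\<close> are the squared singular values; their product is \<open>\<bar>det M\<bar>\<^sup>2\<close> and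
  their sum is the squared Frobenius norm. Splitting off the smallest one and applying the
  arithmetic-geometric mean inequality to the other \<open>n - 1\<close> bounds \<open>\<bar>det M\<bar> / \<sigma>\<^sub>m\<^sub>i\<^sub>n\<close>.
\<close>

section \<open>The arithmetic-geometric mean inequality for lists\<close>

text \<open>The tangent-line bound \<open>x \<le> exp (x - 1)\<close> is multiplied over the list;
  nonnegativity lets the inequalities be multiplied. This is the core of Polya's proof of the
  arithmetic-geometric mean inequality.\<close>

lemma prod_list_le_exp:
  fixes xs :: "real list"
  assumes "\<And>x. x \<in> set xs \<Longrightarrow> x \<ge> 0"
  shows "prod_list xs \<le> exp (sum_list xs - real (length xs))"
  using assms
proof (induction xs)
  case (Cons x xs)
  have "x \<le> exp (x - 1)"
    using exp_ge_add_one_self[of "x - 1"] by simp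
  moreover have "0 \<le> prod_list xs"
    using Cons.prems by (intro prod_list_nonneg) auto
  ultimately have "x * prod_list xs \<le> exp (x - 1) * exp (sum_list xs - real (length xs))"
    using Cons by (intro mult_mono) auto
  also have "\<dots> = exp (sum_list (x # xs) - real (length (x # xs)))"
    by (simp add: exp_add[symmetric] algebra_simps)
  finally show ?case by simp
qed simp

lemma prod_list_map_mult_const:
  "prod_list (map (\<lambda>x. c * x) xs) = c ^ length xs * prod_list (xs :: 'a :: comm_monoid_mult list)"
  by (induction xs) (auto simp: ac_simps)

text \<open>Rescaling reduces this to the exponential bound. Only an upper bound \<open>s\<close> of
  the sum enters, so that the sum of all eigenvalues can later stand in for the sum of all but
  one.\<close>

lemma prod_list_le_mean_power:
  fixes xs :: "real list"
  assumes nonneg: "\<And>x. x \<in> set xs \<Longrightarrow> x \<ge> 0" and "xs \<noteq> []" "sum_list xs \<le> s"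
  shows "prod_list xs \<le> (s / real (length xs)) ^ length xs"
proof -
  define k where "k = length xs"
  have k: "real k > 0" using assms by (simp add: k_def)
  have s: "0 \<le> s" using sum_list_nonneg[of xs] assms by force
  show ?thesis
  \<comment> \<open>The rescaling below divides by \<open>s\<close>. If \<open>s = 0\<close>, all
    entries vanish, and so does their product because the list is nonempty.\<close>
  proof (cases "s = 0")
    case True
    have "sum_list xs = 0" using True assms sum_list_nonneg[of xs] by force
    hence "\<forall>x\<in>set xs. x = 0" using nonneg sum_list_nonneg_eq_0_iff by blast
    hence "hd xs = 0" using assms by simp
    hence "prod_list xs = 0" using assms by (cases xs) auto
    moreover have "0 \<le> (s / real (length xs)) ^ length xs" using s by simp
    ultimately show ?thesis by linarith
  next
    case False
    \<comment> \<open>Dividing each entry by \<open>m\<close> brings the sum down to at most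
      \<open>k\<close>, which makes the exponent in the exponential bound at most 0.\<close>
    define m where "m = s / real k"
    have m: "m > 0" using False s k by (simp add: m_def)
    have "prod_list (map (\<lambda>x. inverse m * x) xs)
        \<le> exp (sum_list (map (\<lambda>x. inverse m * x) xs) - real (length (map (\<lambda>x. inverse m * x) xs)))"
      using nonneg m by (intro prod_list_le_exp) auto
    also have "\<dots> = exp (sum_list xs / m - k)"
      using sum_list_const_mult[of "inverse m" "\<lambda>x. x" xs] by (simp add: k_def divide_inverse_commute)
    also have "\<dots> \<le> 1"
    proof -
      have "sum_list xs / m \<le> s / m" using assms m by (simp add: divide_right_mono)
      also have "\<dots> = k" using k False by (simp add: m_def)
      finally show ?thesis by simp
    qed
    finally have "inverse m ^ k * prod_list xs \<le> 1"
      by (simp add: prod_list_map_mult_const k_def)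
    thus ?thesis using m by (simp add: field_simps m_def[symmetric] k_def[symmetric])
  qed
qed

section \<open>Determinant and trace in terms of the eigenvalues\<close>

lemma trace_mult_commute:
  fixes A B :: "'a :: comm_semiring_0 mat"
  assumes "A \<in> carrier_mat n m" "B \<in> carrier_mat m n"
  shows "(\<Sum>i<n. (A * B) $$ (i, i)) = (\<Sum>i<m. (B * A) $$ (i, i))"
proof -
  have "(\<Sum>i<n. (A * B) $$ (i, i)) = (\<Sum>i<n. \<Sum>j<m. A $$ (i, j) * B $$ (j, i))"
    using assms by (intro sum.cong) (auto simp: scalar_prod_def atLeast0LessThan)
  also have "\<dots> = (\<Sum>j<m. \<Sum>i<n. B $$ (j, i) * A $$ (i, j))"
    by (subst sum.swap) (simp add: mult.commute)
  also have "\<dots> = (\<Sum>j<m. (B * A) $$ (j, j))"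
    using assms by (intro sum.cong) (auto simp: scalar_prod_def atLeast0LessThan)
  finally show ?thesis .
qed

text \<open>Schur triangularisation makes \<open>A\<close> similar to an upper triangular
  \<open>B\<close> with diagonal \<open>es\<close>; determinant and trace are invariant under
  similarity, the trace by cyclicity.\<close>

lemma char_poly_roots_det_trace:
  fixes A :: "complex mat"
  assumes A: "A \<in> carrier_mat n n"
    and cp: "char_poly A = (\<Prod>e\<leftarrow>es. [:- e, 1:])"
  shows "det A = prod_list es" "(\<Sum>i<n. A $$ (i, i)) = sum_list es"
proof -
  obtain B P Q where BPQ: "schur_decomposition A es = (B, P, Q)"
    by (cases "schur_decomposition A es") auto
  from schur_decomposition[OF A cp BPQ]
  have wit: "similar_mat_wit A B P Q" and ut: "upper_triangular B" and diag: "diag_mat B = es"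
    by auto
  note W = similar_mat_witD2[OF A wit]
  have B: "B \<in> carrier_mat n n" using W by auto
  have "similar_mat A B" using wit by (auto simp: similar_mat_def)
  hence "det A = det B" by (rule det_similar)
  thus "det A = prod_list es" using det_upper_triangular[OF ut B] diag by simp
  have "(\<Sum>i<n. A $$ (i, i)) = (\<Sum>i<n. (P * (B * Q)) $$ (i, i))"
    using W by (simp add: assoc_mult_mat[of P n n B n Q n])
  also have "\<dots> = (\<Sum>i<n. ((B * Q) * P) $$ (i, i))"
    using W by (intro trace_mult_commute) auto
  also have "(B * Q) * P = B"
    using W by (simp add: assoc_mult_mat[of B n n Q n P n])
  also have "(\<Sum>i<n. B $$ (i, i)) = sum_list es"
    using B by (simp add: diag[symmetric] diag_mat_def sum_list_sum_nth atLeast0LessThan)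
  finally show "(\<Sum>i<n. A $$ (i, i)) = sum_list es" .
qed

section \<open>The adjoint and the spectrum of the Gram matrix\<close>

lemma mat_adjoint_carrier:
  "A \<in> carrier_mat n m \<Longrightarrow> mat_adjoint A \<in> carrier_mat m n"
  by (auto simp: mat_adjoint_def)

lemma mat_adjoint_index:
  "i < dim_col A \<Longrightarrow> j < dim_row A \<Longrightarrow> mat_adjoint A $$ (i, j) = conjugate (A $$ (j, i))"
  by (auto simp: mat_adjoint_def mat_of_rows_def)

text \<open>The adjoint is the transpose of the entrywise conjugate, and conjugation is a ring
  homomorphism, so it commutes with the determinant.\<close>

lemma det_mat_adjoint:
  fixes A :: "complex mat"
  assumes A: "A \<in> carrier_mat n n"
  shows "det (mat_adjoint A) = cnj (det A)"
proof -
  interpret comm_ring_hom cnj by unfold_locales auto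
  have "mat_adjoint A = transpose_mat (map_mat cnj A)"
    using A mat_adjoint_carrier[OF A] by (intro eq_matI) (auto simp: mat_adjoint_index)
  also have "det \<dots> = det (map_mat cnj A)"
    using A by (intro det_transpose) auto
  finally show ?thesis using hom_det[of A] by simp
qed

lemma trace_gram:
  fixes A :: "complex mat"
  assumes A: "A \<in> carrier_mat n n"
  shows "(\<Sum>i<n. (mat_adjoint A * A) $$ (i, i)) = of_real ((frobenius_norm A)\<^sup>2)"
proof -
  \<comment> \<open>After the swap, diagonal entry \<open>i\<close> is the squared norm of row
    \<open>i\<close>, matching the order of summation in \<open>frobenius_norm\<close>.\<close>
  have "(\<Sum>i<n. (mat_adjoint A * A) $$ (i, i)) = (\<Sum>i<n. (A * mat_adjoint A) $$ (i, i))"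
    using trace_mult_commute[OF mat_adjoint_carrier[OF A] A] .
  also have "\<dots> = (\<Sum>i<n. \<Sum>j<n. of_real ((cmod (A $$ (i, j)))\<^sup>2))"
    using A mat_adjoint_carrier[OF A]
    by (intro sum.cong)
       (auto simp: scalar_prod_def atLeast0LessThan mat_adjoint_index complex_norm_square
             intro!: sum.cong simp del: of_real_power)
  also have "\<dots> = of_real ((frobenius_norm A)\<^sup>2)"
    using A by (simp add: frobenius_norm_def sum_nonneg)
  finally show ?thesis .
qed

lemma mat_adjoint_mult_vec_scalar_prod:
  fixes A :: "complex mat"
  assumes "A \<in> carrier_mat n m" "w \<in> carrier_vec n" "v \<in> carrier_vec m"
  shows "(mat_adjoint A *\<^sub>v w) \<bullet>c v = w \<bullet>c (A *\<^sub>v v)"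
proof -
  have "(mat_adjoint A *\<^sub>v w) \<bullet>c v = (\<Sum>j<m. \<Sum>i<n. cnj (A $$ (i, j)) * w $ i * cnj (v $ j))"
    using assms mat_adjoint_carrier[OF assms(1)]
    by (auto simp: scalar_prod_def atLeast0LessThan mat_adjoint_index sum_distrib_right
             intro!: sum.cong)
  also have "\<dots> = (\<Sum>i<n. \<Sum>j<m. w $ i * (cnj (A $$ (i, j)) * cnj (v $ j)))"
    by (subst sum.swap) (simp add: mult_ac)
  also have "\<dots> = w \<bullet>c (A *\<^sub>v v)"
    using assms by (auto simp: scalar_prod_def atLeast0LessThan sum_distrib_left intro!: sum.cong)
  finally show ?thesis .
qed

text \<open>Pairing the eigenvector equation with \<open>v\<close> gives \<open>e\<close> times the
  squared norm of \<open>v\<close> on one side and the squared norm of \<open>A *\<^sub>v v\<close>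
  on the other. In the order on the complex numbers, \<open>e \<ge> 0\<close> also says that
  \<open>e\<close> is real.\<close>

lemma eigenvalue_gram_nonneg:
  fixes A :: "complex mat"
  assumes A: "A \<in> carrier_mat n n" and "eigenvalue (mat_adjoint A * A) e"
  shows "e \<ge> 0"
proof -
  have A': "mat_adjoint A \<in> carrier_mat n n" using mat_adjoint_carrier[OF A] .
  obtain v where v: "v \<in> carrier_vec n" "v \<noteq> 0\<^sub>v n" and ev: "(mat_adjoint A * A) *\<^sub>v v = e \<cdot>\<^sub>v v"
    using assms A' by (auto simp: eigenvalue_def eigenvector_def)
  have "e * (v \<bullet>c v) = ((mat_adjoint A * A) *\<^sub>v v) \<bullet>c v"
    using v by (simp add: ev)
  also have "\<dots> = (A *\<^sub>v v) \<bullet>c (A *\<^sub>v v)"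
    using A A' v mat_adjoint_mult_vec_scalar_prod[OF A, of "A *\<^sub>v v" v]
    by (simp add: assoc_mult_mat_vec[of _ n n])
  also have "\<dots> \<ge> 0" by (rule conjugate_square_ge_0_vec)
  finally have "e * (v \<bullet>c v) \<ge> 0" .
  moreover have "v \<bullet>c v > 0" using v by simp
  ultimately show ?thesis
    by (auto simp: less_eq_complex_def less_complex_def zero_le_mult_iff)
qed

text \<open>The list \<open>rs\<close> holds the eigenvalues of the Gram matrix with algebraic
  multiplicity. The set \<open>singular_values A\<close> forgets multiplicities, which the product
  and sum formulas require.\<close>

lemma gram_spectrum:
  fixes A :: "complex mat"
  assumes A: "A \<in> carrier_mat n n"
  obtains rs where "length rs = n" "\<And>r. r \<in> set rs \<Longrightarrow> r \<ge> 0"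
    "prod_list rs = (cmod (det A))\<^sup>2" "sum_list rs = (frobenius_norm A)\<^sup>2"
    "singular_values A = sqrt ` set rs"
proof -
  let ?G = "mat_adjoint A * A"
  have A': "mat_adjoint A \<in> carrier_mat n n" using mat_adjoint_carrier[OF A] .
  have G: "?G \<in> carrier_mat n n" using A A' by simp
  obtain es where cp: "char_poly ?G = (\<Prod>e\<leftarrow>es. [:- e, 1:])" and len: "length es = n"
    using char_poly_factorized[OF G] by blast
  have ev: "eigenvalue ?G e \<longleftrightarrow> e \<in> set es" for e
    unfolding eigenvalue_root_char_poly[OF G] cp
    by (auto simp: poly_prod_list prod_list_zero_iff)
  define rs where "rs = map Re es"
  have es_ge: "e \<ge> 0" if "e \<in> set es" for e
    using eigenvalue_gram_nonneg[OF A] ev that by blast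
  hence es: "es = map of_real rs"
    by (auto simp: rs_def o_def less_eq_complex_def complex_eq_iff intro!: map_idI[symmetric])
  have nonneg: "r \<ge> 0" if "r \<in> set rs" for r
    using es_ge that by (auto simp: rs_def less_eq_complex_def)
  have "complex_of_real (prod_list rs) = prod_list es"
    unfolding es by (induction rs) auto
  also have "\<dots> = det ?G"
    using char_poly_roots_det_trace(1)[OF G cp] by simp
  also have "\<dots> = of_real ((cmod (det A))\<^sup>2)"
    using det_mult[OF A' A] det_mat_adjoint[OF A] complex_norm_square[of "det A"]
    by (simp add: mult.commute)
  finally have det: "prod_list rs = (cmod (det A))\<^sup>2" using of_real_eq_iff by blast
  have "complex_of_real (sum_list rs) = sum_list es"
    unfolding es by (induction rs) auto
  also have "\<dots> = of_real ((frobenius_norm A)\<^sup>2)"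
    using char_poly_roots_det_trace(2)[OF G cp] trace_gram[OF A] by simp
  finally have tr: "sum_list rs = (frobenius_norm A)\<^sup>2" using of_real_eq_iff by blast
  have "singular_values A = {s. s \<ge> 0 \<and> s\<^sup>2 \<in> set rs}"
    unfolding singular_values_def ev es by (auto simp del: of_real_power)
  also have "\<dots> = sqrt ` set rs"
    using nonneg by (force simp: image_iff)
  finally show ?thesis
    using that[of rs] len nonneg det tr by (auto simp: rs_def)
qed

section \<open>The determinant bound and the theorem\<close>

text \<open>The product form avoids dividing by \<open>sigma_min A\<close>, so singular matrices are
  covered; for nonzero determinant it forces \<open>sigma_min A\<close> to be positive.\<close>

lemma cmod_det_le_sigma_min:
  fixes A :: "complex mat"
  assumes A: "A \<in> carrier_mat n n" and n: "n \<ge> 2"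
  shows "sigma_min A \<ge> 0"
    and "cmod (det A) \<le> sigma_min A * ((frobenius_norm A)\<^sup>2 / (real n - 1)) powr ((real n - 1) / 2)"
proof -
  obtain rs where rs: "length rs = n" "\<And>r. r \<in> set rs \<Longrightarrow> r \<ge> 0"
    "prod_list rs = (cmod (det A))\<^sup>2" "sum_list rs = (frobenius_norm A)\<^sup>2"
    "singular_values A = sqrt ` set rs"
    using gram_spectrum[OF A] by blast
  have "sigma_min A \<in> sqrt ` set rs"
    unfolding sigma_min_def rs(5) using n rs(1) by (intro Min_in) auto
  then obtain r where r: "r \<in> set rs" "sigma_min A = sqrt r" by auto
  have r0: "r \<ge> 0" using r rs(2) by auto
  thus "sigma_min A \<ge> 0" using r by simp
  define q where "q = (frobenius_norm A)\<^sup>2 / (real n - 1)"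
  have q0: "q \<ge> 0" using n by (simp add: q_def)
  \<comment> \<open>Only one occurrence of \<open>r\<close> is removed, so exactly
    \<open>n - 1\<close> eigenvalues remain even if \<open>r\<close> is a multiple one.\<close>
  let ?ts = "remove1 r rs"
  have len: "length ?ts = n - 1" using r rs by (simp add: length_remove1)
  have "sum_list rs = r + sum_list ?ts"
    using sum_list_map_remove1[OF r(1), of "\<lambda>x. x"] by simp
  \<comment> \<open>Discarding \<open>r\<close> from the trace is why the full Frobenius norm is
    divided by \<open>n - 1\<close> and not by \<open>n\<close>.\<close>
  hence sum: "sum_list ?ts \<le> (frobenius_norm A)\<^sup>2" using r0 rs by simp
  have "prod_list ?ts \<le> ((frobenius_norm A)\<^sup>2 / real (length ?ts)) ^ length ?ts"
  proof (rule prod_list_le_mean_power)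
    show "?ts \<noteq> []" using len n by auto
  qed (use rs(2) sum set_remove1_subset[of r rs] in auto)
  hence *: "prod_list ?ts \<le> q ^ (n - 1)"
    using n by (simp add: len q_def of_nat_diff)
  have "(cmod (det A))\<^sup>2 = r * prod_list ?ts"
    using r(1) unfolding rs(3)[symmetric] by (induction rs) (auto simp: mult_ac)
  also have "\<dots> \<le> r * q ^ (n - 1)"
    using * r0 by (intro mult_left_mono)
  finally have "cmod (det A) \<le> sqrt (r * q ^ (n - 1))"
    by (rule real_le_rsqrt)
  also have "\<dots> = sigma_min A * sqrt (q ^ (n - 1))"
    by (simp add: real_sqrt_mult r)
  also have "sqrt (q ^ (n - 1)) = q powr ((real n - 1) / 2)"
  \<comment> \<open>For \<open>q = 0\<close> both sides are 0: \<open>0 powr x = 0\<close> by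
    convention, and the exponent \<open>n - 1\<close> is positive.\<close>
  proof (cases "q = 0")
    case False
    hence "q > 0" using q0 by simp
    thus ?thesis using n
      by (simp add: powr_half_sqrt[symmetric] powr_realpow[symmetric] powr_powr of_nat_diff)
  qed (use n in simp)
  finally show "cmod (det A) \<le> sigma_min A * ((frobenius_norm A)\<^sup>2 / (real n - 1)) powr ((real n - 1) / 2)"
    by (simp add: q_def)
qed

theorem theorem7:
  fixes f :: "int poly" and n :: nat and as :: "complex list"
  assumes "lead_coeff f = 1"
    and "Factorial_Ring.irreducible f"
    and "degree f = n"
    and "n \<ge> 2"
    and "root_enumeration f as"
  shows "spectral_distortion as
    \<le> ((frobenius_norm (vandermonde_mat as))\<^sup>2 / (real n - 1)) powr ((real n - 1) / 2)
      * cmod (det (vandermonde_mat as)) powr ((1 - real n) / real n)"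
proof (cases "det (vandermonde_mat as) = 0")
  case False
  let ?M = "vandermonde_mat as"
  let ?D = "cmod (det ?M)"
  let ?K = "((frobenius_norm ?M)\<^sup>2 / (real n - 1)) powr ((real n - 1) / 2)"
  have len: "length as = n"
    using root_enumeration_length assms by fastforce
  hence M: "?M \<in> carrier_mat n n" by (simp add: vandermonde_mat_def)
  note bound = cmod_det_le_sigma_min[OF M assms(4)]
  have D: "?D > 0" using False by simp
  \<comment> \<open>If \<open>sigma_min ?M\<close> were 0, the bound would give
    \<open>?D \<le> 0\<close>.\<close>
  have sigma: "sigma_min ?M > 0"
    using bound D by (cases "sigma_min ?M = 0") auto
  \<comment> \<open>The exponents \<open>1 / n\<close> and \<open>(1 - n) / n\<close> differ by 1,
    so one factor \<open>?D\<close> can be split off and bounded.\<close>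
  have "?D = ?D powr (1 / real n) / ?D powr ((1 - real n) / real n)"
    using D assms(4) by (simp add: powr_diff[symmetric] diff_divide_distrib[symmetric])
  hence "?D powr (1 / real n) = ?D * ?D powr ((1 - real n) / real n)"
    using D by (simp add: field_simps)
  also have "\<dots> \<le> (sigma_min ?M * ?K) * ?D powr ((1 - real n) / real n)"
    using bound(2) by (intro mult_right_mono) auto
  finally show ?thesis
    using sigma by (simp add: spectral_distortion_def len field_simps)
qed (simp add: spectral_distortion_def) \<comment> \<open>\<open>0 powr x = 0\<close>, so both sides vanish\<close>

end
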